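(* There exist absolute constants $C_1,C_2>0$ such that the following holds. Let $q$ be a positive odd integer, let $A,B\subseteq\mathbb{Z}_q$ and $\mathcal{A}\subseteq\mathbb{Z}_q^2$ be nonempty sets with $|\mathcal{A}|=\delta q^2$, $|A|=\alpha q$, $|B|=\beta q$, and let $\mathcal{B}=A\times B\subseteq\mathbb{Z}_q^2$. Suppose that all prime divisors of $q$ are at least $M$, where $$M\ge C_1\,\tau(q)\,\delta^{-2}\left(\sqrt{\alpha\beta}\,(\log\log q)^{-1}\right)^{-C_2}.$$ Then $$\mathbb{Z}_q^*\subseteq\{(a_1-b_1)(a_2-b_2): (a_1,a_2)\in\mathcal{A},\ (b_1,b_2)\in\mathcal{B}\}.$$
   Context: $\mathbb{Z}_q=\mathbb{Z}/q\mathbb{Z}$ and $\mathbb{Z}_q^*$ is its group of invertible elements. $\tau(q)$ is the number of all divisors of $q$. Logarithms are to base $2$. *)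

theory Defs
  imports Complex_Main "HOL-Number_Theory.Number_Theory"
begin

text \<open>
  The ring of integers modulo \<open>q\<close> is represented by its canonical representatives
  \<open>0, \<dots>, q - 1\<close>, with arithmetic carried out in \<open>int\<close> and reduced modulo \<open>q\<close>.
\<close>

definition Zmod :: "nat \<Rightarrow> int set" where
  "Zmod q = {0..<int q}"

text \<open>
  The constant \<open>Units (residue_ring 1)\<close> is empty, because \<open>residue_ring\<close> has \<open>1\<close> rather than
  \<open>1 mod m\<close> as its unit. Below, the unit is taken modulo \<open>q\<close>, so that the trivial ring
  (\<open>q = 1\<close>) has \<open>0\<close> as an invertible element; for \<open>q > 1\<close> the two notions agree.
\<close>

definition Zmod_units :: "nat \<Rightarrow> int set" where
  "Zmod_units q = {x \<in> Zmod q. \<exists>y \<in> Zmod q. [x * y = 1] (mod int q)}"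

lemma Zmod_eq_carrier: "Zmod q = carrier (residue_ring (int q))"
  by (auto simp: Zmod_def residue_ring_def)

lemma Zmod_units_eq_Units:
  assumes "q > 1"
  shows "Zmod_units q = Units (residue_ring (int q))"
  using assms
  by (auto simp: Zmod_units_def Zmod_def Units_def residue_ring_def cong_def mult.commute)

lemma Zmod_units_1: "Zmod_units 1 = {0}"
  by (auto simp: Zmod_units_def Zmod_def)

definition divisor_count :: "nat \<Rightarrow> nat" where
  "divisor_count q = card {d. d dvd q}"

end

theory Submission
  imports Defs "HOL-Library.Product_Plus" "HOL-Library.Real_Mod" "HOL-Analysis.Convex"
begin

text \<open>
  By Fourier analysis on \<open>Z_q^2\<close>, the number of solutions with \<open>(a_1 - b_1)(a_2 - b_2) = l\<close> differs
  from its expected value by an error governed by the largest Kloosterman sum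
  \<open>K(\<xi>) = \<Sum> e_q(\<xi>_1 x + \<xi>_2 y)\<close>, over \<open>x y = l\<close>, with \<open>\<xi> \<noteq> 0\<close>. Weil's bound is not needed: Kloosterman's
  own argument gives a saving of \<open>M^(1/4)\<close>, which suffices. The sum \<open>K\<close> is constant along
  the orbit \<open>(v \<xi>_1, v^(-1) \<xi>_2)\<close>, \<open>v\<close> a unit. If \<open>d = gcd(\<xi>_1, \<xi>_2, q)\<close> and \<open>n = q / d\<close>, this orbit
  lies in \<open>d Z_q^2\<close> and covers each of its points at most \<open>d\<close> times, so \<open>\<phi>(q) |K(\<xi>)|^4\<close> is at most
  \<open>d\<close> times the fourth moment of \<open>K\<close> over \<open>d Z_q^2\<close>. That moment counts
  quadruples on the hyperbola with \<open>h_1 + h_2 = h_3 + h_4\<close> modulo \<open>n\<close>, which forces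
  \<open>(x_1 + x_2)(x_1 - x_3)(x_2 - x_3) = 0\<close> modulo \<open>n\<close>. The resulting loss \<open>\<tau>(n)^2 / n\<close> is at most
  \<open>4 / M\<close> when all primes dividing \<open>n\<close> are at least \<open>M \<ge> 4\<close>.
\<close>

section \<open>Additive characters\<close>

text \<open>The standard character e_q, taken on all integers so that arguments need no reduction;
  it descends to residue classes by \<open>add_char_cong\<close>.\<close>

definition add_char :: "nat \<Rightarrow> int \<Rightarrow> complex" where
  "add_char q n = cis (2 * pi * (real_of_int n / real q))"

lemma add_char_0 [simp]: "add_char q 0 = 1"
  by (simp add: add_char_def)

lemma add_char_add: "add_char q (m + n) = add_char q m * add_char q n"
  by (simp add: add_char_def cis_mult add_divide_distrib distrib_left)

lemma norm_add_char [simp]: "norm (add_char q n) = 1"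
  by (simp add: add_char_def)

lemma cnj_add_char: "cnj (add_char q n) = add_char q (- n)"
  by (simp add: add_char_def cis_cnj)

lemma add_char_eq_1_iff:
  assumes "q > 0"
  shows "add_char q n = 1 \<longleftrightarrow> int q dvd n"
proof
  assume "add_char q n = 1"
  then obtain k :: int where "2 * pi * (real_of_int n / real q) = of_int k * (2 * pi)"
    unfolding add_char_def cis_eq_1_iff by blast
  then have "real_of_int n / real q = of_int k"
    using mult_right_cancel[of "2 * pi" "real_of_int n / real q" "of_int k"]
    by (simp add: mult.commute)
  with assms have "real_of_int n = real_of_int (k * int q)"
    by (simp add: field_simps)
  then have "n = k * int q"
    by linarith
  then show "int q dvd n" by simp
next
  assume "int q dvd n"
  then obtain k where "n = int q * k" ..
  with assms show "add_char q n = 1"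
    by (simp add: add_char_def)
qed

lemma add_char_cong:
  assumes "q > 0" "[m = n] (mod int q)"
  shows "add_char q m = add_char q n"
proof -
  have "add_char q (m - n) = 1"
    using assms by (simp add: add_char_eq_1_iff cong_iff_dvd_diff)
  then show ?thesis
    using add_char_add[of q "m - n" n] by simp
qed

text \<open>Turns a frequency divisible by d, modulo d n, into a frequency modulo n. Thus the
  Kloosterman sum at \<xi> is seen to depend only on \<xi> / d modulo q / d.\<close>

lemma add_char_mult_cancel: "d > 0 \<Longrightarrow> add_char (d * n) (int d * m) = add_char n m"
  by (simp add: add_char_def)

lemma add_char_power: "add_char q n ^ k = add_char q (int k * n)"
  by (induction k) (simp_all add: add_char_add algebra_simps)

lemma Zmod_eq_image: "Zmod q = int ` {..<q}"
  by (auto simp: Zmod_def image_iff intro!: bexI[of _ "nat _"])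

lemma finite_Zmod [simp]: "finite (Zmod q)"
  by (simp add: Zmod_def)

lemma card_Zmod [simp]: "card (Zmod q) = q"
  by (simp add: Zmod_def)

lemma mod_in_Zmod [simp]: "q > 0 \<Longrightarrow> x mod int q \<in> Zmod q"
  by (simp add: Zmod_def)

lemma Zmod_eqI: "x \<in> Zmod q \<Longrightarrow> y \<in> Zmod q \<Longrightarrow> [x = y] (mod int q) \<Longrightarrow> x = y"
  by (auto simp: Zmod_def cong_def)

lemma Zmod_eqI_dvd: "x \<in> Zmod q \<Longrightarrow> y \<in> Zmod q \<Longrightarrow> int q dvd x - y \<Longrightarrow> x = y"
  by (rule Zmod_eqI) (auto simp: cong_iff_dvd_diff)

lemma sum_add_char:
  assumes "q > 0"
  shows "(\<Sum>s\<in>Zmod q. add_char q (s * n)) = (if int q dvd n then of_nat q else 0)"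
proof -
  let ?z = "add_char q n"
  have "(\<Sum>s\<in>Zmod q. add_char q (s * n)) = (\<Sum>k<q. ?z ^ k)"
    unfolding Zmod_eq_image by (subst sum.reindex) (auto simp: add_char_power)
  also have "\<dots> = (if int q dvd n then of_nat q else 0)"
  proof (cases "int q dvd n")
    case True
    then have "?z = 1" using assms by (simp add: add_char_eq_1_iff)
    with True show ?thesis by simp
  next
    case False
    then have "?z \<noteq> 1" using assms by (simp add: add_char_eq_1_iff)
    moreover have "?z ^ q = 1"
      using assms by (simp add: add_char_power add_char_eq_1_iff)
    ultimately show ?thesis using False by (simp add: sum_gp_strict)
  qed
  finally show ?thesis .
qed

section \<open>Characters of Z_q^2: orthogonality, Plancherel and the counting inequality\<close>

definition char2 :: "nat \<Rightarrow> int \<times> int \<Rightarrow> int \<times> int \<Rightarrow> complex" where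
  "char2 q \<xi> x = add_char q (fst \<xi> * fst x + snd \<xi> * snd x)"

abbreviation (input) Zmod2 :: "nat \<Rightarrow> (int \<times> int) set" where
  "Zmod2 q \<equiv> Zmod q \<times> Zmod q"

text \<open>Vanishing in Z_q^2, phrased by divisibility because sums and differences of
  representatives leave the range 0, ..., q - 1.\<close>

definition dvd2 :: "nat \<Rightarrow> int \<times> int \<Rightarrow> bool" where
  "dvd2 q x \<longleftrightarrow> int q dvd fst x \<and> int q dvd snd x"

lemma char2_add: "char2 q \<xi> (x + y) = char2 q \<xi> x * char2 q \<xi> y"
  by (simp add: char2_def flip: add_char_add) (simp add: algebra_simps)

lemma char2_diff: "char2 q \<xi> (x - y) = char2 q \<xi> x * cnj (char2 q \<xi> y)"
  by (simp add: char2_def cnj_add_char flip: add_char_add) (simp add: algebra_simps)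

lemma norm_char2 [simp]: "norm (char2 q \<xi> x) = 1"
  by (simp add: char2_def)

lemma char2_0 [simp]: "char2 q 0 x = 1"
  by (simp add: char2_def)

lemma sum_char2:
  assumes "q > 0"
  shows "(\<Sum>\<xi>\<in>Zmod2 q. char2 q \<xi> x) = (if dvd2 q x then of_nat q ^ 2 else 0)"
proof -
  have "(\<Sum>\<xi>\<in>Zmod2 q. char2 q \<xi> x) =
      (\<Sum>s\<in>Zmod q. add_char q (s * fst x)) * (\<Sum>t\<in>Zmod q. add_char q (t * snd x))"
    by (simp add: sum_product sum.cartesian_product char2_def add_char_add split_def)
  then show ?thesis
    using assms by (auto simp: sum_add_char dvd2_def power2_eq_square)
qed

text \<open>Expand the square and use orthogonality. The family f may repeat values: for the fourth
  moment, I consists of pairs of hyperbola points and f adds the two points.\<close>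

lemma char2_plancherel:
  assumes "q > 0" "finite I"
  shows "(\<Sum>\<xi>\<in>Zmod2 q. norm (\<Sum>i\<in>I. char2 q \<xi> (f i)) ^ 2) =
    real q ^ 2 * real (card {p \<in> I \<times> I. dvd2 q (f (fst p) - f (snd p))})"
proof -
  have "complex_of_real (\<Sum>\<xi>\<in>Zmod2 q. norm (\<Sum>i\<in>I. char2 q \<xi> (f i)) ^ 2) =
      (\<Sum>\<xi>\<in>Zmod2 q. \<Sum>(i, j)\<in>I \<times> I. char2 q \<xi> (f i - f j))"
    by (simp add: complex_norm_square sum_product sum.cartesian_product char2_diff split_def
        del: of_real_power)
  also have "\<dots> = (\<Sum>(i, j)\<in>I \<times> I. \<Sum>\<xi>\<in>Zmod2 q. char2 q \<xi> (f i - f j))"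
    by (subst sum.swap) (simp add: split_def)
  also have "\<dots> = (\<Sum>p\<in>I \<times> I. if dvd2 q (f (fst p) - f (snd p)) then of_nat q ^ 2 else 0)"
    using assms by (simp add: sum_char2 split_def)
  also have "\<dots> = of_nat q ^ 2 * of_nat (card {p \<in> I \<times> I. dvd2 q (f (fst p) - f (snd p))})"
    using assms(2) by (simp add: sum.If_cases Int_def)
  finally have "complex_of_real (\<Sum>\<xi>\<in>Zmod2 q. norm (\<Sum>i\<in>I. char2 q \<xi> (f i)) ^ 2) =
      complex_of_real (real q ^ 2 * real (card {p \<in> I \<times> I. dvd2 q (f (fst p) - f (snd p))}))"
    by simp
  then show ?thesis
    by (simp only: of_real_eq_iff)
qed

lemma char2_plancherel_set:
  assumes "q > 0" "S \<subseteq> Zmod2 q"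
  shows "(\<Sum>\<xi>\<in>Zmod2 q. norm (\<Sum>x\<in>S. char2 q \<xi> x) ^ 2) = real q ^ 2 * real (card S)"
proof -
  have fin: "finite S"
    using assms(2) by (rule finite_subset) simp
  have "{p \<in> S \<times> S. dvd2 q (fst p - snd p)} = (\<lambda>x. (x, x)) ` S"
  proof (intro subset_antisym subsetI)
    fix p assume p: "p \<in> {p \<in> S \<times> S. dvd2 q (fst p - snd p)}"
    then have "fst p \<in> Zmod2 q" "snd p \<in> Zmod2 q" and dvd: "dvd2 q (fst p - snd p)"
      using assms(2) by auto
    then have "fst p = snd p"
      by (auto simp: dvd2_def mem_Times_iff intro!: prod_eqI Zmod_eqI_dvd)
    with p show "p \<in> (\<lambda>x. (x, x)) ` S"
      by (cases p) auto
  qed (auto simp: dvd2_def)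
  moreover have "card ((\<lambda>x. (x, x)) ` S) = card S"
    by (rule card_image) (auto simp: inj_on_def)
  ultimately show ?thesis
    using char2_plancherel[OF assms(1) fin, of "\<lambda>x. x"] by simp
qed

text \<open>If a - b never meets H, the frequency sum that counts solutions vanishes, so its term at
  0, of size |H| |S| |T|, is balanced by the other frequencies. There the sum over H is at most
  \<kappa>, and Cauchy-Schwarz with Plancherel handles the sums over S and T.\<close>

lemma no_differences_bound:
  fixes H S T :: "(int \<times> int) set" and \<kappa> :: real
  assumes q: "q > 0" and H: "finite H" and S: "S \<subseteq> Zmod2 q" and T: "T \<subseteq> Zmod2 q"
    and no_sol: "\<And>a b h. a \<in> S \<Longrightarrow> b \<in> T \<Longrightarrow> h \<in> H \<Longrightarrow> \<not> dvd2 q (h + b - a)"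
    and \<kappa>: "\<kappa> \<ge> 0" "\<And>\<xi>. \<xi> \<in> Zmod2 q \<Longrightarrow> \<xi> \<noteq> 0 \<Longrightarrow> norm (\<Sum>h\<in>H. char2 q \<xi> h) \<le> \<kappa>"
  shows "real (card H) ^ 2 * real (card S) * real (card T) \<le> \<kappa> ^ 2 * real q ^ 4"
proof -
  define K where "K \<xi> = (\<Sum>h\<in>H. char2 q \<xi> h)" for \<xi>
  define F where "F U \<xi> = (\<Sum>x\<in>U. char2 q \<xi> x)" for U \<xi>
  \<comment> \<open>Permits cancelling |S| |T| at the end even when a set is empty: the left side is
    then 0.\<close>
  have cancel: "h * x * y \<le> c"
    if le: "(x * y) * (h * x * y) \<le> (x * y) * c" and "0 \<le> c" "0 \<le> x" "0 \<le> y" for h x y c :: real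
  proof (cases "x = 0 \<or> y = 0")
    case False
    with that have "0 < x * y" by simp
    with le show ?thesis by (simp only: mult_le_cancel_left_pos)
  qed (use \<open>0 \<le> c\<close> in auto)
  have fin: "finite S" "finite T"
    using finite_subset[OF S] finite_subset[OF T] by simp_all
  have "(\<Sum>\<xi>\<in>Zmod2 q. K \<xi> * F T \<xi> * cnj (F S \<xi>)) =
      (\<Sum>\<xi>\<in>Zmod2 q. \<Sum>a\<in>S. \<Sum>b\<in>T. \<Sum>h\<in>H. char2 q \<xi> (h + b - a))"
    unfolding K_def F_def
    by (simp add: char2_diff char2_add sum_distrib_left sum_distrib_right mult.assoc) 
  \<comment> \<open>With the frequency sum innermost, orthogonality turns each term into an
    indicator of h + b = a, and no such triple exists.\<close>
  also have "\<dots> = (\<Sum>a\<in>S. \<Sum>b\<in>T. \<Sum>h\<in>H. \<Sum>\<xi>\<in>Zmod2 q. char2 q \<xi> (h + b - a))"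
    by (subst sum.swap, rule sum.cong[OF refl], subst sum.swap, rule sum.cong[OF refl], subst sum.swap, rule refl)
  also have "\<dots> = 0"
    using q no_sol by (simp add: sum_char2)
  finally have zero: "(\<Sum>\<xi>\<in>Zmod2 q. K \<xi> * F T \<xi> * cnj (F S \<xi>)) = 0" .
  have 0: "0 \<in> Zmod2 q"
    using q by (simp add: zero_prod_def Zmod_def)
  have "K 0 * F T 0 * cnj (F S 0) = - (\<Sum>\<xi>\<in>Zmod2 q - {0}. K \<xi> * F T \<xi> * cnj (F S \<xi>))"
    using zero sum.remove[OF _ 0, of "\<lambda>\<xi>. K \<xi> * F T \<xi> * cnj (F S \<xi>)"]
    by (simp add: eq_neg_iff_add_eq_0)
  moreover have "norm (K 0 * F T 0 * cnj (F S 0)) = real (card H) * real (card T) * real (card S)"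
    by (simp add: K_def F_def norm_mult)
  ultimately have "real (card H) * real (card T) * real (card S) \<le>
      (\<Sum>\<xi>\<in>Zmod2 q - {0}. norm (K \<xi> * F T \<xi> * cnj (F S \<xi>)))"
    using norm_sum[of "\<lambda>\<xi>. K \<xi> * F T \<xi> * cnj (F S \<xi>)" "Zmod2 q - {0}"] by simp
  also have "\<dots> \<le> (\<Sum>\<xi>\<in>Zmod2 q - {0}. \<kappa> * (norm (F T \<xi>) * norm (F S \<xi>)))"
    using \<kappa>(2) by (intro sum_mono) (auto simp: norm_mult mult.assoc K_def intro!: mult_right_mono)
  also have "\<dots> \<le> (\<Sum>\<xi>\<in>Zmod2 q. \<kappa> * (norm (F T \<xi>) * norm (F S \<xi>)))"
    using \<kappa>(1) by (intro sum_mono2) auto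
  finally have "(real (card H) * real (card T) * real (card S)) ^ 2 \<le>
      (\<kappa> * (\<Sum>\<xi>\<in>Zmod2 q. norm (F T \<xi>) * norm (F S \<xi>))) ^ 2"
    by (intro power_mono) (auto simp: sum_distrib_left)
  also have "\<dots> \<le> \<kappa> ^ 2 * ((\<Sum>\<xi>\<in>Zmod2 q. norm (F T \<xi>) ^ 2) * (\<Sum>\<xi>\<in>Zmod2 q. norm (F S \<xi>) ^ 2))"
    unfolding power_mult_distrib
    by (intro mult_left_mono Cauchy_Schwarz_ineq_sum) auto
  also have "\<dots> = \<kappa> ^ 2 * ((real q ^ 2 * real (card T)) * (real q ^ 2 * real (card S)))"
    unfolding F_def using char2_plancherel_set[OF q] S T by simp
  finally have "(real (card S) * real (card T)) * (real (card H) ^ 2 * real (card S) * real (card T)) \<le>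
      (real (card S) * real (card T)) * (\<kappa> ^ 2 * real q ^ 4)"
    by (simp add: power_mult_distrib power2_eq_square power4_eq_xxxx mult_ac)
  moreover have "0 \<le> \<kappa> ^ 2 * real q ^ 4"
    using \<kappa>(1) by simp
  ultimately show ?thesis
    by (rule cancel) simp_all
qed

section \<open>The modular hyperbola and a divisor count\<close>

text \<open>For l = 1 this is the set of pairs (v, v^(-1)), which later stands for the unit group
  acting on frequencies.\<close>

definition hyperbola :: "nat \<Rightarrow> int \<Rightarrow> (int \<times> int) set" where
  "hyperbola q l = {h \<in> Zmod2 q. [fst h * snd h = l] (mod int q)}"

lemma finite_hyperbola [simp]: "finite (hyperbola q l)"
  by (simp add: hyperbola_def)

lemma coprime_hyperbola:
  assumes "h \<in> hyperbola q l" "coprime l (int q)"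
  shows "coprime (fst h) (int q)" "coprime (snd h) (int q)"
proof -
  have "coprime (fst h * snd h) (int q)"
    using assms by (auto simp: hyperbola_def dest: cong_imp_coprime[OF cong_sym])
  then show "coprime (fst h) (int q)" "coprime (snd h) (int q)"
    by simp_all
qed

lemma inj_on_fst_hyperbola:
  assumes "coprime l (int q)"
  shows "inj_on fst (hyperbola q l)"
proof (rule inj_onI)
  fix h h' assume h: "h \<in> hyperbola q l" and h': "h' \<in> hyperbola q l" and eq: "fst h = fst h'"
  have "[fst h * snd h = fst h * snd h'] (mod int q)"
    using h h' eq by (auto simp: hyperbola_def intro: cong_trans cong_sym)
  then have "[snd h = snd h'] (mod int q)"
    using coprime_hyperbola(1)[OF h assms] by (simp add: cong_mult_lcancel)
  with h h' eq show "h = h'"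
    by (auto simp: hyperbola_def intro!: prod_eqI Zmod_eqI)
qed

text \<open>The first coordinate can be any unit x and then forces y = l / x, so the size is
  \<phi>(q) for every unit l.\<close>

lemma card_hyperbola:
  assumes "q > 0" "coprime l (int q)"
  shows "card (hyperbola q l) = card {x \<in> Zmod q. coprime x (int q)}"
proof -
  have "fst ` hyperbola q l = {x \<in> Zmod q. coprime x (int q)}"
  proof (intro subset_antisym subsetI)
    fix x assume "x \<in> fst ` hyperbola q l"
    then show "x \<in> {x \<in> Zmod q. coprime x (int q)}"
      using coprime_hyperbola(1)[OF _ assms(2)] by (auto simp: hyperbola_def)
  next
    fix x assume x: "x \<in> {x \<in> Zmod q. coprime x (int q)}"
    then obtain y where y: "[x * y = 1] (mod int q)"
      using cong_solve_coprime_int by blast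
    have "[x * ((y * l) mod int q) = (x * y) * l] (mod int q)"
      by (metis cong_mod_left cong_mult cong_refl mult.assoc)
    also have "[(x * y) * l = 1 * l] (mod int q)"
      using y by (rule cong_mult) simp
    finally have "(x, (y * l) mod int q) \<in> hyperbola q l"
      using x assms(1) by (simp add: hyperbola_def)
    then show "x \<in> fst ` hyperbola q l"
      by force
  qed
  then show ?thesis
    using card_image[OF inj_on_fst_hyperbola[OF assms(2)]] by simp
qed

section \<open>Counting residue classes and zeros of a product of three residues\<close>

lemma card_residue_class_le:
  assumes "d > 0" "n > 0"
  shows "card {x \<in> Zmod (d * n). [x = a] (mod int n)} \<le> d"
proof -
  have "x \<in> (\<lambda>k. a mod int n + int n * k) ` Zmod d" if x: "x \<in> Zmod (d * n)" "[x = a] (mod int n)" for x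
  proof (rule image_eqI)
    show "x = a mod int n + int n * (x div int n)"
      using x(2) by (metis cong_def mod_mult_div_eq)
    have "int n * (x div int n) \<le> x"
      using assms by (simp add: minus_mod_eq_mult_div [symmetric])
    also have "x < int n * int d"
      using x(1) by (simp add: Zmod_def mult.commute)
    finally have "x div int n < int d"
      using assms by simp
    then show "x div int n \<in> Zmod d"
      using x(1) assms by (simp add: Zmod_def pos_imp_zdiv_nonneg_iff)
  qed
  then have "card {x \<in> Zmod (d * n). [x = a] (mod int n)} \<le> card ((\<lambda>k. a mod int n + int n * k) ` Zmod d)"
    by (intro card_mono) auto
  also have "\<dots> \<le> d"
    using card_image_le[of "Zmod d"] by simp
  finally show ?thesis .
qed

lemma card_multiples_le:
  assumes "q > 0" "g dvd q"
  shows "real (card {x \<in> Zmod q. int g dvd x}) \<le> real q / real g"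
proof -
  obtain d where d: "q = d * g"
    using assms(2) by (metis dvdE mult.commute)
  with assms have "d > 0" "g > 0" by auto
  with card_residue_class_le[OF this, of 0] show ?thesis
    by (simp add: d cong_0_iff)
qed

text \<open>If n divides a b c, then n = g h i with g, h, i dividing a, b, c respectively. There are
  at most \<tau>(n)^2 choices of (g, h), which fix i, and each choice allows at most (q/g) (q/h)
  (q/i) = q^3 / n triples.\<close>

lemma card_product_zero_le:
  assumes q: "q > 0" and n: "n dvd q"
  shows "real (card {(a, b, c). a \<in> Zmod q \<and> b \<in> Zmod q \<and> c \<in> Zmod q \<and> int n dvd a * b * c})
    \<le> real (divisor_count n) ^ 2 * real q ^ 3 / real n"
proof -
  define m where "m g = {x \<in> Zmod q. int g dvd x}" for g
  define D where "D = {d. d dvd n}"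
  define G where "G = {p \<in> D \<times> D. fst p * snd p dvd n}"
  have n0: "n > 0" using q n by (auto intro: Nat.gr0I)
  have finD: "finite D" unfolding D_def using n0 by simp
  have finG: "finite G" unfolding G_def using finD by simp
  have "p \<in> (\<Union>(g, h)\<in>G. m g \<times> m h \<times> m (n div (g * h)))"
    if p: "p \<in> {(a, b, c). a \<in> Zmod q \<and> b \<in> Zmod q \<and> c \<in> Zmod q \<and> int n dvd a * b * c}" for p
  proof -
    obtain a b c where p_eq: "p = (a, b, c)" and abc: "a \<in> Zmod q" "b \<in> Zmod q" "c \<in> Zmod q"
      and dvd: "int n dvd a * b * c"
      using p by auto
    obtain g' h' i where g': "int n = g' * i" "g' dvd a * b" "i dvd c"
      using division_decomp[OF dvd] by metis
    obtain g h where gh: "g' = g * h" "g dvd a" "h dvd b"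
      using division_decomp[OF g'(2)] by metis
    \<comment> \<open>The decomposition over the integers fixes the factors only up to sign;
      absolute values give natural divisors.\<close>
    define g1 h1 i1 where "g1 = nat \<bar>g\<bar>" and "h1 = nat \<bar>h\<bar>" and "i1 = nat \<bar>i\<bar>"
    have "n = g1 * h1 * i1"
      using arg_cong[OF g'(1), of "\<lambda>t. nat \<bar>t\<bar>"] 
      by (simp add: gh g1_def h1_def i1_def abs_mult nat_mult_distrib)
    then have "n div (g1 * h1) = i1" and "(g1, h1) \<in> G"
      using n0 by (auto simp: G_def D_def)
    moreover have "int g1 dvd a" "int h1 dvd b" "int i1 dvd c"
      using gh g' by (simp_all add: g1_def h1_def i1_def)
    ultimately show ?thesis
      using abc by (intro UN_I[of "(g1, h1)"]) (simp_all add: m_def p_eq)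
  qed
  then have "card {(a, b, c). a \<in> Zmod q \<and> b \<in> Zmod q \<and> c \<in> Zmod q \<and> int n dvd a * b * c} \<le>
      card (\<Union>(g, h)\<in>G. m g \<times> m h \<times> m (n div (g * h)))"
    by (intro card_mono finite_UN_I finG subsetI) (auto simp: m_def)
  also have "\<dots> \<le> (\<Sum>p\<in>G. card (m (fst p) \<times> m (snd p) \<times> m (n div (fst p * snd p))))"
    using card_UN_le[OF finG] by (simp add: split_def)
  finally have "real (card {(a, b, c). a \<in> Zmod q \<and> b \<in> Zmod q \<and> c \<in> Zmod q \<and> int n dvd a * b * c}) \<le>
      (\<Sum>p\<in>G. real (card (m (fst p) \<times> m (snd p) \<times> m (n div (fst p * snd p)))))"
    unfolding of_nat_sum[symmetric] of_nat_le_iff .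
  also have "\<dots> \<le> (\<Sum>p\<in>G. real q ^ 3 / real n)"
  proof (rule sum_mono)
    fix p assume "p \<in> G"
    then obtain g h where p: "p = (g, h)" and gh: "g dvd n" "h dvd n" "g * h dvd n"
      by (auto simp: G_def D_def)
    then obtain i where i: "n = g * h * i" by (auto elim: dvdE)
    with n0 have pos: "g > 0" "h > 0" "i > 0" by auto
    have "n div (g * h) = i" using i pos by simp
    have "real (card (m g \<times> m h \<times> m i)) \<le> (real q / real g) * ((real q / real h) * (real q / real i))"
      unfolding card_cartesian_product of_nat_mult m_def
      using i n by (intro mult_mono card_multiples_le q) (auto intro: dvd_trans)
    also have "\<dots> = real q ^ 3 / real n"
      by (simp add: i power3_eq_cube)
    finally show "real (card (m (fst p) \<times> m (snd p) \<times> m (n div (fst p * snd p)))) \<le> real q ^ 3 / real n"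
      by (simp add: p \<open>n div (g * h) = i\<close>)
  qed
  also have "\<dots> = real (card G) * (real q ^ 3 / real n)" by simp
  also have "\<dots> \<le> real (divisor_count n) ^ 2 * (real q ^ 3 / real n)"
  proof -
    have "card G \<le> card (D \<times> D)"
      using finD by (intro card_mono) (auto simp: G_def)
    then have "card G \<le> divisor_count n ^ 2"
      by (simp add: card_cartesian_product divisor_count_def D_def power2_eq_square)
    then have "real (card G) \<le> real (divisor_count n) ^ 2"
      unfolding of_nat_power[symmetric] of_nat_le_iff .
    then show ?thesis by (rule mult_right_mono) simp
  qed
  finally show ?thesis by simp
qed

section \<open>Kloosterman sums\<close>

lemma char2_cong:
  assumes "q > 0" "[fst \<xi> * fst x = fst \<xi>' * fst x'] (mod int q)"
    "[snd \<xi> * snd x = snd \<xi>' * snd x'] (mod int q)"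
  shows "char2 q \<xi> x = char2 q \<xi>' x'"
  unfolding char2_def using assms by (intro add_char_cong cong_add)

lemma inverse_scale_mod:
  assumes "[v * w = 1] (mod int q)" "x \<in> Zmod q"
  shows "w * (v * x mod int q) mod int q = x"
proof -
  have "[w * (v * x) = (v * w) * x] (mod int q)"
    by (simp add: mult_ac)
  also have "[(v * w) * x = 1 * x] (mod int q)"
    using assms(1) by (rule cong_mult) simp
  finally have "w * (v * x) mod int q = x mod int q"
    by (simp add: cong_def)
  then show ?thesis
    using assms(2) by (simp add: mod_mult_right_eq Zmod_def)
qed

text \<open>The map (x, y) to (v x, w y) permutes the hyperbola because v w = 1, so rescaling the
  frequency only reorders the sum. One large Kloosterman sum therefore comes with many equal
  ones.\<close>

lemma kloosterman_orbit:
  assumes q: "q > 0" and vw: "[v * w = 1] (mod int q)"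
  shows "(\<Sum>h\<in>hyperbola q l. char2 q (v * fst \<xi>, w * snd \<xi>) h) = (\<Sum>h\<in>hyperbola q l. char2 q \<xi> h)"
proof -
  have wv: "[w * v = 1] (mod int q)"
    using vw by (simp add: mult.commute)
  \<comment> \<open>Generic in v and w, because the inverse of \<open>sc v w\<close> is
    \<open>sc w v\<close>.\<close>
  define sc where "sc v w h = (v * fst h mod int q, w * snd h mod int q)" for v w :: int and h
  have sc_hyperbola: "sc v w h \<in> hyperbola q l"
    if vw: "[v * w = 1] (mod int q)" and h: "h \<in> hyperbola q l" for v w h
  proof -
    have "[(v * fst h mod int q) * (w * snd h mod int q) = (v * fst h) * (w * snd h)] (mod int q)"
      by (simp add: cong_def mod_mult_eq)
    also have "(v * fst h) * (w * snd h) = (v * w) * (fst h * snd h)"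
      by (simp add: mult_ac)
    also have "[(v * w) * (fst h * snd h) = 1 * l] (mod int q)"
      using vw h by (intro cong_mult) (auto simp: hyperbola_def)
    finally show ?thesis
      using q by (simp add: hyperbola_def sc_def)
  qed
  have sc_inv: "sc w v (sc v w h) = h"
    if "[v * w = 1] (mod int q)" "[w * v = 1] (mod int q)" "h \<in> hyperbola q l" for v w h
    using that by (auto simp: sc_def hyperbola_def inverse_scale_mod intro!: prod_eqI)
  show ?thesis
  proof (rule sum.reindex_bij_witness[where i = "sc w v" and j = "sc v w"])
    fix h assume "h \<in> hyperbola q l"
    show "char2 q \<xi> (sc v w h) = char2 q (v * fst \<xi>, w * snd \<xi>) h"
      by (rule char2_cong[OF q]) (simp_all add: sc_def cong_def mod_mult_right_eq mult_ac)
  qed (use sc_hyperbola sc_inv vw wv in auto)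
qed

text \<open>With s = x1 + x2 and t = y1 + y2, the points (x3, y3) and (s - x3, t - y3) both lie on
  the hyperbola modulo n. Eliminating the y's leaves l s (s x3 - x1 x2 - x3^2) = 0, whose last
  factor is -(x1 - x3) (x2 - x3).\<close>

lemma hyperbola_energy_dvd:
  fixes n :: int
  assumes xy: "[x1 * y1 = l] (mod n)" "[x2 * y2 = l] (mod n)" "[x3 * y3 = l] (mod n)" "[x4 * y4 = l] (mod n)"
    and x: "n dvd x1 + x2 - (x3 + x4)" and y: "n dvd y1 + y2 - (y3 + y4)" and l: "coprime l n"
  shows "n dvd (x1 + x2) * (x1 - x3) * (x2 - x3)"
proof -
  define s t where "s = x1 + x2" and "t = y1 + y2"
  have d: "n dvd x1 * y1 - l" "n dvd x2 * y2 - l" "n dvd x3 * y3 - l" "n dvd x4 * y4 - l"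
    using xy by (simp_all add: cong_iff_dvd_diff)
  \<comment> \<open>Modulo n this expresses (s - x3) (t - y3) = x4 y4 = l = x3 y3.\<close>
  have "s * t - s * y3 - t * x3 =
      (x1 + x2 - (x3 + x4)) * (t - y3) + x4 * (y1 + y2 - (y3 + y4)) + (x4 * y4 - l) - (x3 * y3 - l)"
    by (simp add: s_def t_def algebra_simps)
  moreover have "n dvd \<dots>"
    by (intro dvd_add dvd_diff dvd_mult dvd_mult2 x y d)
  ultimately have E1: "n dvd s * t - s * y3 - t * x3" by simp
  have "t * x1 * x2 - l * s = x2 * (x1 * y1 - l) + x1 * (x2 * y2 - l)"
    by (simp add: s_def t_def algebra_simps)
  moreover have "n dvd \<dots>"
    by (intro dvd_add dvd_mult d)
  ultimately have E2: "n dvd t * x1 * x2 - l * s" by simp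
  \<comment> \<open>Combines both relations so that t cancels, and removes y3 by x3 y3 = l. The unit
    l can then be cancelled.\<close>
  have "l * (s * (s * x3 - x1 * x2 - x3 * x3)) = x1 * x2 * x3 * (s * t - s * y3 - t * x3)
      - (s * x3 - x3 * x3) * (t * x1 * x2 - l * s) + s * x1 * x2 * (x3 * y3 - l)"
    by (simp add: algebra_simps)
  moreover have "n dvd \<dots>"
    by (intro dvd_add dvd_diff dvd_mult E1 E2 d)
  ultimately have "n dvd l * (s * (s * x3 - x1 * x2 - x3 * x3))" by simp
  then have "n dvd s * (s * x3 - x1 * x2 - x3 * x3)"
    using l by (simp add: coprime_commute coprime_dvd_mult_right_iff)
  moreover have "(x1 + x2) * (x1 - x3) * (x2 - x3) = - (s * (s * x3 - x1 * x2 - x3 * x3))"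
    by (simp add: s_def algebra_simps)
  ultimately show ?thesis by simp
qed

text \<open>
  As \<open>q\<close> is odd, the linear forms \<open>x + y\<close>, \<open>x - z\<close>, \<open>y - z\<close> (of determinant 2) are
  independent modulo \<open>q\<close>.
\<close>

lemma card_energy_factor_le:
  assumes q: "odd q" and n: "n dvd q"
  shows "card {(x, y, z). x \<in> Zmod q \<and> y \<in> Zmod q \<and> z \<in> Zmod q \<and> int n dvd (x + y) * (x - z) * (y - z)} \<le>
    card {(a, b, c). a \<in> Zmod q \<and> b \<in> Zmod q \<and> c \<in> Zmod q \<and> int n dvd a * b * c}"
    (is "card ?T \<le> card ?Z")
proof (rule card_inj_on_le)
  have q0: "q > 0" using q by (auto intro: Nat.gr0I)
  define f :: "int \<times> int \<times> int \<Rightarrow> int \<times> int \<times> int"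
    where "f = (\<lambda>(x, y, z). ((x + y) mod int q, (x - z) mod int q, (y - z) mod int q))"
  show "inj_on f ?T"
  proof (rule inj_onI)
    fix p p' assume p: "p \<in> ?T" and p': "p' \<in> ?T" and eq: "f p = f p'"
    obtain x y z x' y' z' where pp: "p = (x, y, z)" "p' = (x', y', z')"
      by (metis prod_cases3)
    have A: "int q dvd (x + y) - (x' + y')" "int q dvd (x - z) - (x' - z')" "int q dvd (y - z) - (y' - z')"
      using eq by (simp_all add: f_def pp mod_eq_dvd_iff)
    have "2 * (x - x') = ((x + y) - (x' + y')) + ((x - z) - (x' - z')) - ((y - z) - (y' - z'))"
      by simp
    then have "int q dvd 2 * (x - x')"
      using A by (metis dvd_add dvd_diff)
    moreover have "coprime (int q) 2"
      using q by simp
    ultimately have x: "int q dvd x - x'"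
      by (simp only: coprime_dvd_mult_right_iff)
    have "(x + y) - (x' + y') - (x - x') = y - y'" "(x - x') - ((x - z) - (x' - z')) = z - z'"
      by simp_all
    then have "int q dvd y - y'" "int q dvd z - z'"
      using A x by (metis dvd_diff)+
    with x p p' show "p = p'"
      by (auto simp: pp intro: Zmod_eqI_dvd)
  qed
  show "f ` ?T \<subseteq> ?Z"
  proof (rule image_subsetI)
    fix p assume "p \<in> ?T"
    then obtain x y z where p: "p = (x, y, z)" and dvd: "int n dvd (x + y) * (x - z) * (y - z)"
      by auto
    have m: "[u mod int q = u] (mod int n)" for u
      by (rule cong_dvd_modulus[of _ _ "int q"]) (use n in \<open>simp_all add: cong_def\<close>)
    have "[((x + y) mod int q) * ((x - z) mod int q) * ((y - z) mod int q) = (x + y) * (x - z) * (y - z)] (mod int n)"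
      by (intro cong_mult m)
    with dvd have "int n dvd ((x + y) mod int q) * ((x - z) mod int q) * ((y - z) mod int q)"
      by (simp add: cong_dvd_iff)
    then show "f p \<in> ?Z"
      using q0 by (simp add: f_def p)
  qed
  show "finite ?Z"
    by (rule finite_subset[of _ "Zmod q \<times> Zmod q \<times> Zmod q"]) auto
qed

text \<open>By Plancherel the moment is n^2 times the number of quadruples with h1 + h2 = h3 + h4
  modulo n. The first three x coordinates satisfy the factored divisibility, and each such triple
  extends to at most d quadruples.\<close>

lemma kloosterman_fourth_moment:
  assumes q: "odd q" "q = d * n" and l: "coprime l (int q)"
  shows "(\<Sum>\<eta>\<in>Zmod2 n. norm (\<Sum>h\<in>hyperbola q l. char2 n \<eta> h) ^ 4) \<le>
    real n * real d * real (divisor_count n) ^ 2 * real q ^ 3"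
proof -
  have q0: "q > 0" and dn: "d > 0" "n > 0" "n dvd q" using q by (auto intro!: Nat.gr0I)
  have nq: "int n dvd int q" using dn by simp
  let ?H = "hyperbola q l"
  define E where "E = {r \<in> (?H \<times> ?H) \<times> (?H \<times> ?H).
    dvd2 n (fst (fst r) + snd (fst r) - (fst (snd r) + snd (snd r)))}"
  define T where "T = {(x, y, z). x \<in> Zmod q \<and> y \<in> Zmod q \<and> z \<in> Zmod q \<and>
    int n dvd (x + y) * (x - z) * (y - z)}"
  \<comment> \<open>The relation gives x4 only modulo n, which leaves at most d values modulo q = d
    n.\<close>
  define C where "C p = {w \<in> Zmod q. [w = fst p + fst (snd p) - snd (snd p)] (mod int n)}" for p :: "int \<times> int \<times> int"
  \<comment> \<open>The y coordinates can be forgotten: on the hyperbola x determines y.\<close>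
  define f :: "((int \<times> int) \<times> int \<times> int) \<times> (int \<times> int) \<times> int \<times> int \<Rightarrow> (int \<times> int \<times> int) \<times> int"
    where "f = (\<lambda>((h1, h2), (h3, h4)). ((fst h1, fst h2, fst h3), fst h4))"
  have finT: "finite T"
    by (rule finite_subset[of _ "Zmod q \<times> Zmod q \<times> Zmod q"]) (auto simp: T_def)
  have "card E \<le> card (Sigma T C)"
  proof (rule card_inj_on_le)
    show "inj_on f E"
    proof -
      have "y = y'" if "(x, y) \<in> ?H" "(x, y') \<in> ?H" for x y y'
        using inj_onD[OF inj_on_fst_hyperbola[OF l] _ that] by simp
      then show ?thesis
        by (auto simp: f_def E_def intro!: inj_onI)
    qed
    show "f ` E \<subseteq> Sigma T C"
    proof (rule image_subsetI)
      fix r assume r: "r \<in> E"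
      obtain x1 y1 x2 y2 x3 y3 x4 y4 where req: "r = (((x1, y1), (x2, y2)), ((x3, y3), (x4, y4)))"
        by (metis surj_pair)
      have dvd: "int n dvd x1 + x2 - (x3 + x4)" "int n dvd y1 + y2 - (y3 + y4)"
        using r by (simp_all add: E_def req dvd2_def)
      have xs: "x1 \<in> Zmod q" "x2 \<in> Zmod q" "x3 \<in> Zmod q" "x4 \<in> Zmod q"
        using r by (simp_all add: E_def req hyperbola_def)
      have eqs: "[x1 * y1 = l] (mod int n)" "[x2 * y2 = l] (mod int n)"
        "[x3 * y3 = l] (mod int n)" "[x4 * y4 = l] (mod int n)"
        using r nq by (auto simp: E_def req hyperbola_def intro: cong_dvd_modulus)
      have "coprime l (int n)"
        using l dn(3) by (metis coprime_divisors dvd_refl nq)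
      from hyperbola_energy_dvd[OF eqs dvd this] have "(x1, x2, x3) \<in> T"
        using xs by (simp add: T_def)
      moreover have "x4 - (x1 + x2 - x3) = - (x1 + x2 - (x3 + x4))" by simp
      then have "int n dvd x4 - (x1 + x2 - x3)"
        using dvd(1) by (metis dvd_minus_iff)
      then have "x4 \<in> C (x1, x2, x3)"
        using xs by (simp add: C_def cong_iff_dvd_diff)
      ultimately show "f r \<in> Sigma T C"
        by (simp add: f_def req)
    qed
    show "finite (Sigma T C)"
      by (rule finite_SigmaI[OF finT]) (simp add: C_def)
  qed
  also have "\<dots> = (\<Sum>p\<in>T. card (C p))"
    by (rule card_SigmaI[OF finT]) (simp add: C_def)
  also have "\<dots> \<le> (\<Sum>p\<in>T. d)"
    unfolding C_def q(2) by (intro sum_mono card_residue_class_le dn)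
  also have "\<dots> \<le> card {(a, b, c). a \<in> Zmod q \<and> b \<in> Zmod q \<and> c \<in> Zmod q \<and> int n dvd a * b * c} * d"
    using card_energy_factor_le[OF q(1) dn(3)] by (simp add: T_def)
  finally have "real (card E) \<le>
      real (card {(a, b, c). a \<in> Zmod q \<and> b \<in> Zmod q \<and> c \<in> Zmod q \<and> int n dvd a * b * c}) * real d"
    unfolding of_nat_mult[symmetric] of_nat_le_iff .
  also have "\<dots> \<le> real (divisor_count n) ^ 2 * real q ^ 3 / real n * real d"
    by (intro mult_right_mono card_product_zero_le q0 dn) simp
  finally have E: "real (card E) \<le> real (divisor_count n) ^ 2 * real q ^ 3 / real n * real d" .
  \<comment> \<open>The square of the sum is a character sum over pairs, so Plancherel evaluates the
    fourth moment.\<close>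
  have "norm (\<Sum>h\<in>?H. char2 n \<eta> h) ^ 4 = norm (\<Sum>p\<in>?H \<times> ?H. char2 n \<eta> (fst p + snd p)) ^ 2" for \<eta>
  proof -
    have "(\<Sum>p\<in>?H \<times> ?H. char2 n \<eta> (fst p + snd p)) = (\<Sum>h\<in>?H. char2 n \<eta> h) ^ 2"
      by (simp add: power2_eq_square sum_product sum.cartesian_product char2_add split_def)
    then show ?thesis
      by (simp add: norm_power)
  qed
  then have "(\<Sum>\<eta>\<in>Zmod2 n. norm (\<Sum>h\<in>?H. char2 n \<eta> h) ^ 4) = real n ^ 2 * real (card E)"
    using char2_plancherel[OF dn(2), of "?H \<times> ?H" "\<lambda>p. fst p + snd p"] by (simp add: E_def)
  also have "\<dots> \<le> real n ^ 2 * (real (divisor_count n) ^ 2 * real q ^ 3 / real n * real d)"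
    by (intro mult_left_mono E) simp
  also have "\<dots> = real n * real d * real (divisor_count n) ^ 2 * real q ^ 3"
    using dn by (simp add: power2_eq_square)
  finally show ?thesis .
qed

text \<open>Here n = q / gcd(\<xi>_1, \<xi>_2, q) is the order of \<xi> in Z_q^2, and the saving is
  governed by n. As \<xi> is not 0, n > 1, so n has a prime factor, which divides q.\<close>

lemma kloosterman_bound:
  assumes q: "odd q" and l: "coprime l (int q)" and \<xi>: "\<xi> \<in> Zmod2 q" "\<xi> \<noteq> 0"
  obtains n where "n dvd q" "n > 1"
    "real (card (hyperbola q 1)) * norm (\<Sum>h\<in>hyperbola q l. char2 q \<xi> h) ^ 4 \<le>
      real (divisor_count n) ^ 2 / real n * real q ^ 5"
proof -
  have q0: "q > 0" using q by (auto intro: Nat.gr0I)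
  define g where "g = gcd (gcd (fst \<xi>) (snd \<xi>)) (int q)"
  define d where "d = nat g"
  have g: "g > 0" using q0 by (simp add: g_def)
  have dvd: "int d dvd fst \<xi>" "int d dvd snd \<xi>" "int d dvd int q"
    using g by (simp_all add: d_def) (auto simp: g_def intro: dvd_trans[OF gcd_dvd1])
  from dvd(1) obtain a where a: "fst \<xi> = int d * a" ..
  from dvd(2) obtain b where b: "snd \<xi> = int d * b" ..
  from dvd(3) have "d dvd q" by simp
  then obtain n where n: "q = d * n" ..
  have dn: "d > 0" "n > 0" using q0 by (simp_all add: n)
  have gab: "gcd (gcd a b) (int n) = 1"
  proof -
    have "int d * gcd (gcd a b) (int n) = gcd (gcd (int d * a) (int d * b)) (int d * int n)"
      using gcd_mult_distrib_int[of "int d" "gcd a b" "int n"] gcd_mult_distrib_int[of "int d" a b]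
      by (simp only: abs_of_nat)
    also have "\<dots> = g"
      unfolding g_def a b n of_nat_mult ..
    also have "\<dots> = int d"
      using g by (simp add: d_def)
    finally have "int d * gcd (gcd a b) (int n) = int d" .
    then show ?thesis using dn by simp
  qed
  have n1: "n \<noteq> 1"
  proof
    assume "n = 1"
    with n a b have "int q dvd fst \<xi> - 0" "int q dvd snd \<xi> - 0" by simp_all
    then have "fst \<xi> = 0" "snd \<xi> = 0"
      using \<xi>(1) q0 by (auto intro!: Zmod_eqI_dvd simp: Zmod_def)
    then show False using \<xi>(2) by (simp add: prod_eq_iff)
  qed
  let ?U = "hyperbola q 1"
  define G where "G \<eta> = norm (\<Sum>h\<in>hyperbola q l. char2 n \<eta> h) ^ 4" for \<eta>
  \<comment> \<open>The orbit of \<xi> / d = (a, b) modulo n, parametrised by the pairs u = (v,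
    v^(-1)).\<close>
  define \<phi> where "\<phi> u = (fst u * a mod int n, snd u * b mod int n)" for u :: "int \<times> int"
  have orbit: "norm (\<Sum>h\<in>hyperbola q l. char2 q \<xi> h) ^ 4 = G (\<phi> u)" if u: "u \<in> ?U" for u
  proof -
    have "(\<Sum>h\<in>hyperbola q l. char2 q \<xi> h) = (\<Sum>h\<in>hyperbola q l. char2 q (fst u * fst \<xi>, snd u * snd \<xi>) h)"
      using u by (intro kloosterman_orbit[OF q0, symmetric]) (simp add: hyperbola_def)
    also have "\<dots> = (\<Sum>h\<in>hyperbola q l. char2 n (\<phi> u) h)"
    proof (rule sum.cong[OF refl])
      fix h
      have "char2 q (fst u * fst \<xi>, snd u * snd \<xi>) h =
          add_char (d * n) (int d * (fst u * a * fst h + snd u * b * snd h))"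
        by (simp add: char2_def a b n algebra_simps)
      also have "\<dots> = char2 n (fst u * a, snd u * b) h"
        using dn by (simp add: add_char_mult_cancel char2_def)
      also have "\<dots> = char2 n (\<phi> u) h"
        by (rule char2_cong[OF dn(2)]) (simp_all add: \<phi>_def cong_def mod_mult_left_eq)
      finally show "char2 q (fst u * fst \<xi>, snd u * snd \<xi>) h = char2 n (\<phi> u) h" .
    qed
    finally show ?thesis by (simp add: G_def)
  qed
  have fibre: "card {u \<in> ?U. \<phi> u = \<eta>} \<le> d" for \<eta>
  proof (cases "{u \<in> ?U. \<phi> u = \<eta>} = {}")
    case False
    then obtain v where v: "v \<in> ?U" "\<phi> v = \<eta>" by blast
    have "card {u \<in> ?U. \<phi> u = \<eta>} \<le> card {x \<in> Zmod q. [x = fst v] (mod int n)}"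
    proof (rule card_inj_on_le[of fst])
      show "inj_on fst {u \<in> ?U. \<phi> u = \<eta>}"
        by (rule inj_on_subset[OF inj_on_fst_hyperbola[of 1 q]]) auto
      show "fst ` {u \<in> ?U. \<phi> u = \<eta>} \<subseteq> {x \<in> Zmod q. [x = fst v] (mod int n)}"
      proof (rule image_subsetI)
        fix u assume "u \<in> {u \<in> ?U. \<phi> u = \<eta>}"
        then have u: "u \<in> ?U" "\<phi> u = \<eta>" by auto
        have "\<phi> u = \<phi> v" using u v by simp
        then have "int n dvd fst u * a - fst v * a" and "int n dvd snd u * b - snd v * b"
          by (simp_all add: \<phi>_def mod_eq_dvd_iff)
        then have A: "int n dvd (fst u - fst v) * a" and B: "int n dvd (snd u - snd v) * b"
          by (simp_all add: left_diff_distrib)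
        have "int n dvd fst u * snd u - 1" "int n dvd fst v * snd v - 1"
          using u(1) v(1) n by (auto simp: hyperbola_def cong_iff_dvd_diff intro: dvd_trans[of "int n" "int q"])
        \<comment> \<open>Write u, v for the two units. Multiplying b / u = b / v by u v gives (u -
          v) b = 0 modulo n. Together with (u - v) a = 0 and gcd(a, b, n) = 1 this yields u = v
          modulo n.\<close>
        from dvd_diff[OF dvd_diff[OF dvd_mult[OF this(1)] dvd_mult[OF this(2)]] dvd_mult[OF B]]
        have "int n dvd fst v * b * (fst u * snd u - 1) - fst u * b * (fst v * snd v - 1)
            - fst u * fst v * ((snd u - snd v) * b)" .
        also have "fst v * b * (fst u * snd u - 1) - fst u * b * (fst v * snd v - 1)
            - fst u * fst v * ((snd u - snd v) * b) = (fst u - fst v) * b"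
          by (simp add: algebra_simps)
        finally have "int n dvd gcd ((fst u - fst v) * a) ((fst u - fst v) * b)"
          using A by simp
        then have "int n dvd (fst u - fst v) * gcd a b"
          by (simp add: gcd_mult_left)
        moreover have "coprime (int n) (gcd a b)"
          using gab by (simp add: coprime_iff_gcd_eq_1 gcd.commute)
        ultimately have "int n dvd fst u - fst v"
          by (simp add: coprime_dvd_mult_left_iff)
        then show "fst u \<in> {x \<in> Zmod q. [x = fst v] (mod int n)}"
          using u(1) by (simp add: hyperbola_def mem_Times_iff cong_iff_dvd_diff)
      qed
    qed simp
    also have "\<dots> \<le> d"
      unfolding n by (rule card_residue_class_le[OF dn])
    finally show ?thesis .
  qed (simp only: card.empty le0)
  have "real (card ?U) * norm (\<Sum>h\<in>hyperbola q l. char2 q \<xi> h) ^ 4 =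
      (\<Sum>u\<in>?U. norm (\<Sum>h\<in>hyperbola q l. char2 q \<xi> h) ^ 4)"
    by simp
  also have "\<dots> = (\<Sum>u\<in>?U. G (\<phi> u))"
    by (rule sum.cong[OF refl]) (rule orbit)
  \<comment> \<open>Grouping the orbit by its image: fibres have at most d elements, so d times the
    full fourth moment is an upper bound.\<close>
  also have "\<dots> = (\<Sum>\<eta>\<in>Zmod2 n. \<Sum>u\<in>{u \<in> ?U. \<phi> u = \<eta>}. G (\<phi> u))"
    using dn by (intro sum.group[symmetric]) (auto simp: \<phi>_def)
  also have "\<dots> = (\<Sum>\<eta>\<in>Zmod2 n. real (card {u \<in> ?U. \<phi> u = \<eta>}) * G \<eta>)"
    by (rule sum.cong[OF refl]) simp
  also have "\<dots> \<le> (\<Sum>\<eta>\<in>Zmod2 n. real d * G \<eta>)"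
    using fibre by (intro sum_mono mult_right_mono) (auto simp: G_def)
  also have "\<dots> = real d * (\<Sum>\<eta>\<in>Zmod2 n. G \<eta>)"
    by (simp add: sum_distrib_left)
  also have "\<dots> \<le> real d * (real n * real d * real (divisor_count n) ^ 2 * real q ^ 3)"
    unfolding G_def by (intro mult_left_mono kloosterman_fourth_moment q n l) simp
  \<comment> \<open>Since d n = q, the factor d^2 n equals q^2 / n.\<close>
  also have "\<dots> = real (divisor_count n) ^ 2 / real n * real q ^ 5"
    using dn by (simp add: n field_simps eval_nat_numeral)
  finally show thesis
    using that[of n] n n1 dn by auto
qed

section \<open>Solving the equation on the hyperbola\<close>

lemma divisor_count_pos: "n > 0 \<Longrightarrow> divisor_count n > 0"
  unfolding divisor_count_def by (subst card_gt_0_iff) auto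

text \<open>A divisor of p m either divides m or is p times a divisor of m.\<close>

lemma divisor_count_prime_mult_le:
  assumes p: "prime p" and m: "m > 0"
  shows "divisor_count (p * m) \<le> 2 * divisor_count m"
proof -
  let ?D = "{d. d dvd m}"
  have fin: "finite ?D" using m by simp
  have "{d. d dvd p * m} \<subseteq> ?D \<union> (*) p ` ?D"
  proof
    fix k assume "k \<in> {d. d dvd p * m}"
    then have k: "k dvd p * m" by simp
    show "k \<in> ?D \<union> (*) p ` ?D"
    proof (cases "p dvd k")
      case True
      then obtain k' where "k = p * k'" ..
      with k p show ?thesis by auto
    next
      case False
      then have "coprime p k" using p by (rule prime_imp_coprime[rotated])
      with k show ?thesis by (simp add: coprime_dvd_mult_right_iff coprime_commute)
    qed
  qed
  then have "divisor_count (p * m) \<le> card (?D \<union> (*) p ` ?D)"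
    unfolding divisor_count_def using fin by (intro card_mono) auto
  also have "\<dots> \<le> card ?D + card ((*) p ` ?D)"
    by (rule card_Un_le)
  also have "\<dots> \<le> 2 * divisor_count m"
    using card_image_le[OF fin, of "(*) p"] by (simp add: divisor_count_def)
  finally show ?thesis .
qed

text \<open>Removing one prime p costs a factor 4 in \<tau>(n)^2. The last prime pays for M, and
  every other one pays for its own 4 because p \<ge> M \<ge> 4.\<close>

lemma divisor_count_sq_le:
  fixes M :: real
  assumes "n > 1" "\<And>p. prime p \<Longrightarrow> p dvd n \<Longrightarrow> M \<le> real p" "M \<ge> 4"
  shows "real (divisor_count n) ^ 2 * M \<le> 4 * real n"
  using assms(1,2)
proof (induction n rule: less_induct)
  case (less n)
  obtain p where p: "prime p" "p dvd n"
    using less.prems(1) prime_factor_nat[of n] by auto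
  then obtain m where m: "n = p * m" by blast
  have m0: "m > 0" using m less.prems(1) by (auto intro: Nat.gr0I)
  have pM: "M \<le> real p" using less.prems(2) p by blast
  have "divisor_count n \<le> 2 * divisor_count m"
    unfolding m using p(1) m0 by (rule divisor_count_prime_mult_le)
  then have "real (divisor_count n) \<le> 2 * real (divisor_count m)"
    by linarith
  then have "real (divisor_count n) ^ 2 \<le> (2 * real (divisor_count m)) ^ 2"
    by (intro power_mono) auto
  then have le: "real (divisor_count n) ^ 2 * M \<le> 4 * (real (divisor_count m) ^ 2 * M)"
    using assms(3) mult_right_mono[of "real (divisor_count n) ^ 2" "4 * real (divisor_count m) ^ 2" M]
    by (simp add: power_mult_distrib)
  show ?case
  proof (cases "m = 1")
    case True
    then have "real (divisor_count m) = 1"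
      by (simp add: divisor_count_def)
    with le pM True m show ?thesis by simp
  next
    case False
    have "m < n" using m m0 p(1) prime_gt_1_nat by simp
    then have "real (divisor_count m) ^ 2 * M \<le> 4 * real m"
      using False m0 less.prems(2) m by (intro less.IH) auto
    with le have "real (divisor_count n) ^ 2 * M \<le> 4 * (4 * real m)" by linarith
    also have "\<dots> \<le> 4 * (real p * real m)"
      using pM assms(3) by (intro mult_left_mono mult_right_mono) auto
    finally show ?thesis by (simp add: m)
  qed
qed

text \<open>A union bound: every non-unit is a multiple of some prime p dividing q. There are at
  most \<tau>(q) \<le> M / 2 such primes, each with at most q / M multiples.\<close>

lemma card_coprime_ge_half:
  fixes M :: real
  assumes q: "q > 0" and M: "\<And>p. prime p \<Longrightarrow> p dvd q \<Longrightarrow> M \<le> real p" "2 * real (divisor_count q) \<le> M"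
  shows "real q / 2 \<le> real (card {x \<in> Zmod q. coprime x (int q)})"
proof -
  define P where "P = {p. prime p \<and> p dvd q}"
  let ?D = "{d. d dvd q}" and ?C = "{x \<in> Zmod q. coprime x (int q)}"
  have "finite ?D" using q by simp
  then have finP: "finite P" by (rule finite_subset[rotated]) (auto simp: P_def)
  have M0: "M > 0" using divisor_count_pos[OF q] M(2) by simp
  have "Zmod q - ?C \<subseteq> (\<Union>p\<in>P. {x \<in> Zmod q. int p dvd x})"
  proof
    fix x assume x: "x \<in> Zmod q - ?C"
    then have "\<not> coprime x (int q)" by auto
    then have "nat (gcd x (int q)) \<noteq> 1"
      by (simp add: coprime_iff_gcd_eq_1)
    then obtain p where p: "prime p" "p dvd nat (gcd x (int q))"
      using prime_factor_nat by blast
    from p(2) have "int p dvd int (nat (gcd x (int q)))"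
      by (simp only: int_dvd_int_iff)
    then have "int p dvd gcd x (int q)" by simp
    then have "int p dvd x" "p dvd q" by simp_all
    with x p show "x \<in> (\<Union>p\<in>P. {x \<in> Zmod q. int p dvd x})"
      by (auto simp: P_def)
  qed
  then have "card (Zmod q - ?C) \<le> card (\<Union>p\<in>P. {x \<in> Zmod q. int p dvd x})"
    using finP by (intro card_mono) auto
  also have "\<dots> \<le> (\<Sum>p\<in>P. card {x \<in> Zmod q. int p dvd x})"
    by (rule card_UN_le[OF finP])
  finally have "real (card (Zmod q - ?C)) \<le> (\<Sum>p\<in>P. real (card {x \<in> Zmod q. int p dvd x}))"
    unfolding of_nat_sum[symmetric] of_nat_le_iff .
  also have "\<dots> \<le> (\<Sum>p\<in>P. real q / M)"
  proof (rule sum_mono)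
    fix p assume "p \<in> P"
    then have "p dvd q" "M \<le> real p" using M(1) by (auto simp: P_def)
    then have "real (card {x \<in> Zmod q. int p dvd x}) \<le> real q / real p"
      by (intro card_multiples_le q)
    also have "\<dots> \<le> real q / M"
      using M0 \<open>M \<le> real p\<close> by (intro divide_left_mono) auto
    finally show "real (card {x \<in> Zmod q. int p dvd x}) \<le> real q / M" .
  qed
  also have "\<dots> = real (card P) * (real q / M)" by simp
  also have "\<dots> \<le> (M / 2) * (real q / M)"
  proof (rule mult_right_mono)
    have "card P \<le> divisor_count q"
      unfolding divisor_count_def using \<open>finite ?D\<close> by (intro card_mono) (auto simp: P_def)
    then show "real (card P) \<le> M / 2" using M(2) by simp
  qed (use M0 in simp)
  also have "\<dots> = real q / 2" using M0 by simp
  finally have "real (card (Zmod q - ?C)) \<le> real q / 2" .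
  moreover have "card (Zmod q - ?C) + card ?C = q"
    using card_Diff_subset[of ?C "Zmod q"] card_mono[of "Zmod q" ?C] by auto
  then have "real (card (Zmod q - ?C)) + real (card ?C) = real q"
    by (metis of_nat_add)
  ultimately show ?thesis by linarith
qed

text \<open>From 8 \<le> 9 follows log 3 \<ge> 3/2, and from 2 \<le> 9/4 follows log (3/2) \<ge>
  1/2.\<close>

lemma log2_log2_ge_half:
  assumes "q \<ge> (3 :: real)"
  shows "log 2 (log 2 q) \<ge> 1 / 2"
proof -
  have "(2 powr (3 / 2)) ^ 2 \<le> (3 :: real) ^ 2"
    by (simp add: powr_power)
  then have "2 powr (3 / 2) \<le> (3 :: real)"
    by (rule power2_le_imp_le) simp
  with assms have "log 2 q \<ge> 3 / 2"
    by (subst le_log_iff) auto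
  moreover have "(2 powr (1 / 2)) ^ 2 \<le> (3 / 2 :: real) ^ 2"
    by (simp add: powr_power power_divide)
  then have "2 powr (1 / 2) \<le> (3 / 2 :: real)"
    by (rule power2_le_imp_le) simp
  ultimately show ?thesis
    by (subst le_log_iff) auto
qed

text \<open>Without a solution, \<open>no_differences_bound\<close> and \<phi>(q) \<ge> q / 2 give
  |S| |T| \<le> 4 \<kappa>^2 q^2. The square of this contradicts \<open>large\<close>.\<close>

lemma hyperbola_solvable:
  fixes M :: real
  assumes q: "odd q" "q > 1" and S: "S \<subseteq> Zmod2 q" and T: "T \<subseteq> Zmod2 q" and l: "l \<in> Zmod_units q"
    and M: "\<And>p. prime p \<Longrightarrow> p dvd q \<Longrightarrow> M \<le> real p" "2 * real (divisor_count q) \<le> M"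
    and large: "128 * real q ^ 8 < M * (real (card S) * real (card T)) ^ 2"
  obtains a b where "a \<in> S" "b \<in> T" "(fst a - fst b) * (snd a - snd b) mod int q = l"
proof (rule ccontr)
  assume "\<not> thesis"
  with that have none: "\<And>a b. a \<in> S \<Longrightarrow> b \<in> T \<Longrightarrow> (fst a - fst b) * (snd a - snd b) mod int q \<noteq> l"
    by blast
  have q0: "q > 0" using q by simp
  have lq: "coprime l (int q)" and lZ: "l \<in> Zmod q"
    using l by (auto simp: Zmod_units_def coprime_iff_invertible_int)
  \<comment> \<open>The divisors 1 and q are distinct, so \<tau>(q) \<ge> 2 and hence M \<ge> 4, as
    \<open>divisor_count_sq_le\<close> requires.\<close>
  have "card {1, q} \<le> divisor_count q"
    unfolding divisor_count_def using q0 by (intro card_mono) auto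
  with q(2) M(2) have M4: "M \<ge> 4" by simp
  \<comment> \<open>Chosen so that (q / 2) \<kappa>^4 = (4 / M) q^5, combining \<phi>(q) \<ge> q / 2
    with \<tau>(n)^2 / n \<le> 4 / M.\<close>
  define \<kappa> where "\<kappa> = sqrt (sqrt (8 * real q ^ 4 / M))"
  have \<kappa>: "\<kappa> \<ge> 0" "\<kappa> ^ 4 = 8 * real q ^ 4 / M"
    using M4 power_mult[of \<kappa> 2 2] by (simp_all add: \<kappa>_def)
  have half: "real q / 2 \<le> real (card (hyperbola q l'))" if "coprime l' (int q)" for l'
    using card_coprime_ge_half[OF q0 M] card_hyperbola[OF q0 that] by simp
  have "real (card (hyperbola q l)) ^ 2 * real (card S) * real (card T) \<le> \<kappa> ^ 2 * real q ^ 4"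
  proof (rule no_differences_bound[OF q0 _ S T _ \<kappa>(1)])
    fix a b h assume ab: "a \<in> S" "b \<in> T" and h: "h \<in> hyperbola q l"
    show "\<not> dvd2 q (h + b - a)"
    proof
      assume "dvd2 q (h + b - a)"
      then have "[fst h = fst a - fst b] (mod int q)" "[snd h = snd a - snd b] (mod int q)"
        by (simp_all add: dvd2_def cong_iff_dvd_diff algebra_simps)
      then have "[fst h * snd h = (fst a - fst b) * (snd a - snd b)] (mod int q)"
        by (rule cong_mult)
      moreover have "[fst h * snd h = l] (mod int q)"
        using h by (simp add: hyperbola_def)
      ultimately have "(fst a - fst b) * (snd a - snd b) mod int q = l mod int q"
        by (simp add: cong_def)
      with none[OF ab] lZ show False by (simp add: Zmod_def)
    qed
  next
    fix \<xi> assume \<xi>: "\<xi> \<in> Zmod2 q" "\<xi> \<noteq> 0"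
    define k where "k = norm (\<Sum>h\<in>hyperbola q l. char2 q \<xi> h)"
    obtain n where n: "n dvd q" "n > 1"
      and le: "real (card (hyperbola q 1)) * k ^ 4 \<le> real (divisor_count n) ^ 2 / real n * real q ^ 5"
      using kloosterman_bound[OF q(1) lq \<xi>] unfolding k_def by metis
    have "real (divisor_count n) ^ 2 * M \<le> 4 * real n"
      using n M(1) M4 by (intro divisor_count_sq_le) (auto intro: dvd_trans)
    then have "real (divisor_count n) ^ 2 / real n \<le> 4 / M"
      using n M4 by (simp add: field_simps)
    then have "real (divisor_count n) ^ 2 / real n * real q ^ 5 \<le> 4 / M * real q ^ 5"
      by (rule mult_right_mono) simp
    moreover have "real q / 2 * k ^ 4 \<le> real (card (hyperbola q 1)) * k ^ 4"
      by (intro mult_right_mono half) (auto simp: k_def)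
    ultimately have "real q / 2 * k ^ 4 \<le> 4 / M * real q ^ 5"
      using le by linarith
    also have "\<dots> = real q / 2 * \<kappa> ^ 4"
      unfolding \<kappa>(2) by (simp add: eval_nat_numeral)
    finally have "k ^ 4 \<le> \<kappa> ^ 4"
      using q0 by simp
    then show "norm (\<Sum>h\<in>hyperbola q l. char2 q \<xi> h) \<le> \<kappa>"
      unfolding k_def[symmetric] using \<kappa>(1) by (rule power_le_imp_le_base[where n = 3, simplified])
  qed simp
  moreover have "(real q / 2) ^ 2 * (real (card S) * real (card T)) \<le> real (card (hyperbola q l)) ^ 2 * (real (card S) * real (card T))"
    by (intro mult_right_mono power_mono half[OF lq]) auto
  ultimately have "(real q / 2) ^ 2 * (real (card S) * real (card T)) \<le> \<kappa> ^ 2 * real q ^ 4"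
    by (simp add: mult.assoc)
  then have "real q ^ 2 * (real (card S) * real (card T)) \<le> real q ^ 2 * (4 * \<kappa> ^ 2 * real q ^ 2)"
    by (simp add: power_divide eval_nat_numeral algebra_simps)
  then have "real (card S) * real (card T) \<le> 4 * \<kappa> ^ 2 * real q ^ 2"
    using q0 by simp
  \<comment> \<open>Squaring produces \<kappa>^4, which is known explicitly; 16 * 8 = 128 is the
    constant in \<open>large\<close>.\<close>
  then have "(real (card S) * real (card T)) ^ 2 \<le> (4 * \<kappa> ^ 2 * real q ^ 2) ^ 2"
    by (rule power_mono) simp
  also have "\<dots> = 16 * \<kappa> ^ 4 * real q ^ 4"
    by (simp add: power_mult_distrib flip: power_mult)
  also have "\<dots> = 128 * real q ^ 8 / M"
    unfolding \<kappa>(2) by (simp flip: power_add)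
  finally have "M * (real (card S) * real (card T)) ^ 2 \<le> 128 * real q ^ 8"
    using M4 by (simp add: field_simps)
  with large show False by simp
qed

section \<open>Choice of the constants and deduction of the theorem\<close>

theorem theorem12:
  shows "\<exists>C\<^sub>1 C\<^sub>2 :: real. C\<^sub>1 > 0 \<and> C\<^sub>2 > 0 \<and>
    (\<forall>(q :: nat) (A :: int set) (B :: int set) (\<A> :: (int \<times> int) set)
       (\<alpha> :: real) (\<beta> :: real) (\<delta> :: real) (M :: real).
       q > 0 \<longrightarrow> odd q \<longrightarrow>
       A \<subseteq> Zmod q \<longrightarrow> B \<subseteq> Zmod q \<longrightarrow> \<A> \<subseteq> Zmod q \<times> Zmod q \<longrightarrow>
       A \<noteq> {} \<longrightarrow> B \<noteq> {} \<longrightarrow> \<A> \<noteq> {} \<longrightarrow>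
       real (card \<A>) = \<delta> * real q ^ 2 \<longrightarrow>
       real (card A) = \<alpha> * real q \<longrightarrow>
       real (card B) = \<beta> * real q \<longrightarrow>
       (\<forall>p. prime p \<and> p dvd q \<longrightarrow> M \<le> real p) \<longrightarrow>
       M \<ge> C\<^sub>1 * real (divisor_count q) * \<delta> powi (-2) *
            (sqrt (\<alpha> * \<beta>) * inverse (log 2 (log 2 (real q)))) powr (- C\<^sub>2) \<longrightarrow>
       Zmod_units q \<subseteq>
         {((a\<^sub>1 - b\<^sub>1) * (a\<^sub>2 - b\<^sub>2)) mod int q | a\<^sub>1 a\<^sub>2 b\<^sub>1 b\<^sub>2.
            (a\<^sub>1, a\<^sub>2) \<in> \<A> \<and> (b\<^sub>1, b\<^sub>2) \<in> A \<times> B})"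
\<comment> \<open>The exponent 4 turns the square root into (\<alpha> \<beta>)^2, on a par with
  \<delta>^2. As 3200 / 2^4 = 200, the hypothesis gives M (\<delta> \<alpha> \<beta>)^2 \<ge> 200
  \<tau>(q), more than the 128 required.\<close>
proof (rule exI[of _ 3200], rule exI[of _ 4], intro conjI allI impI subsetI)
  fix q :: nat and A B :: "int set" and \<A> :: "(int \<times> int) set" and \<alpha> \<beta> \<delta> M :: real and l :: int
  assume q: "q > 0" "odd q" and sub: "A \<subseteq> Zmod q" "B \<subseteq> Zmod q" "\<A> \<subseteq> Zmod q \<times> Zmod q"
    and ne: "A \<noteq> {}" "B \<noteq> {}" "\<A> \<noteq> {}"
    and card: "real (card \<A>) = \<delta> * real q ^ 2" "real (card A) = \<alpha> * real q" "real (card B) = \<beta> * real q"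
    and primes: "\<forall>p. prime p \<and> p dvd q \<longrightarrow> M \<le> real p"
    and M: "M \<ge> 3200 * real (divisor_count q) * \<delta> powi (-2) *
      (sqrt (\<alpha> * \<beta>) * inverse (log 2 (log 2 (real q)))) powr (- 4)"
    and l: "l \<in> Zmod_units q"
  \<comment> \<open>For \<open>q = 1\<close> the logarithms take junk values and the claim is trivial; for \<open>q = 3\<close> the
    iterated logarithm is below 1 but at least 1/2, and the factor \<open>2 ^ 4\<close> in 3200 absorbs this.\<close>
  have "\<exists>a\<in>\<A>. \<exists>b\<in>A \<times> B. (fst a - fst b) * (snd a - snd b) mod int q = l"
  proof (cases "q = 1")
    case True
    then have "l = 0"
      using l by (simp add: Zmod_units_def Zmod_def)
    then have "(fst a - fst b) * (snd a - snd b) mod int q = l" for a b :: "int \<times> int"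
      using True by simp
    moreover obtain a b where "a \<in> \<A>" "b \<in> A \<times> B"
      using ne by blast
    ultimately show ?thesis
      by blast
  next
    case False
    with q have q3: "q \<ge> 3"
      by (metis One_nat_def Suc_1 Suc_leI even_numeral less_one linorder_neqE_nat nat_neq_iff numeral_3_eq_3 le_neq_implies_less)
    have pos: "\<alpha> > 0" "\<beta> > 0" "\<delta> > 0"
    proof -
      have "finite A" "finite B" "finite \<A>"
        using finite_subset[OF sub(1)] finite_subset[OF sub(2)] finite_subset[OF sub(3)] by simp_all
      then have "real (card A) > 0" "real (card B) > 0" "real (card \<A>) > 0"
        using ne by (simp_all add: card_gt_0_iff)
      then show "\<alpha> > 0" "\<beta> > 0" "\<delta> > 0"
        using q(1) unfolding card by (simp_all add: zero_less_mult_iff)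
    qed
    have le1: "\<alpha> \<le> 1" "\<beta> \<le> 1" "\<delta> \<le> 1"
    proof -
      have "card A \<le> q" "card B \<le> q" "card \<A> \<le> q * q"
        using card_mono[OF _ sub(1)] card_mono[OF _ sub(2)] card_mono[OF _ sub(3)]
        by (simp_all add: card_cartesian_product)
      then have "\<alpha> * real q \<le> 1 * real q" "\<beta> * real q \<le> 1 * real q" "\<delta> * real q ^ 2 \<le> 1 * real q ^ 2"
        unfolding card[symmetric] by (simp_all add: power2_eq_square flip: of_nat_mult)
      then show "\<alpha> \<le> 1" "\<beta> \<le> 1" "\<delta> \<le> 1"
        using q(1) by (simp_all only: mult_le_cancel_right_pos zero_less_power of_nat_0_less_iff)
    qed
    define L where "L = log 2 (log 2 (real q))"
    \<comment> \<open>The product of the two cardinalities is x q^4, so the size condition of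
      \<open>hyperbola_solvable\<close> reads 128 < M x^2.\<close>
    define x where "x = \<delta> * \<alpha> * \<beta>"
    have x: "0 < x" "x \<le> 1"
      using pos le1 by (auto simp: x_def intro!: mult_le_one)
    have L: "L \<ge> 1 / 2"
      unfolding L_def using q3 by (intro log2_log2_ge_half) simp
    have "(sqrt (\<alpha> * \<beta>) * inverse L) powr (- 4) = inverse ((sqrt (\<alpha> * \<beta>) * inverse L) ^ 4)"
      using pos L by (simp add: powr_minus)
    also have "\<dots> = L ^ 4 / (\<alpha> * \<beta>) ^ 2"
      using pos power_mult[of "sqrt (\<alpha> * \<beta>)" 2 2] by (simp add: power_mult_distrib divide_simps)
    finally have "M \<ge> 3200 * real (divisor_count q) * inverse (\<delta> ^ 2) * (L ^ 4 / (\<alpha> * \<beta>) ^ 2)"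
      using M by (simp add: power_int_minus L_def)
    moreover have "3200 * real (divisor_count q) * inverse (\<delta> ^ 2) * (L ^ 4 / (\<alpha> * \<beta>) ^ 2) \<ge>
        3200 * real (divisor_count q) * inverse (\<delta> ^ 2) * ((1 / 2) ^ 4 / (\<alpha> * \<beta>) ^ 2)"
      using L by (intro mult_left_mono divide_right_mono power_mono) auto
    moreover have "3200 * real (divisor_count q) * inverse (\<delta> ^ 2) * ((1 / 2) ^ 4 / (\<alpha> * \<beta>) ^ 2) =
        200 * real (divisor_count q) / x ^ 2"
      by (simp add: x_def power_mult_distrib field_simps)
    ultimately have "200 * real (divisor_count q) / x ^ 2 \<le> M" by linarith
    then have Mx: "200 * real (divisor_count q) \<le> M * x ^ 2"
      using x by (simp add: field_simps)
    have M0: "M > 0"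
      using Mx divisor_count_pos[OF q(1)] by (metis mult_nonpos_nonneg not_le of_nat_0_less_iff order_less_le_trans zero_le_power2 zero_less_mult_iff zero_less_numeral)
    \<comment> \<open>As x \<le> 1, the same bound also gives M \<ge> 2 \<tau>(q), which the
      estimate for the number of units needs.\<close>
    have "M * x ^ 2 \<le> M * 1"
      using x M0 by (intro mult_left_mono power_le_one) auto
    with Mx have M2: "2 * real (divisor_count q) \<le> M" by linarith
    have "real (divisor_count q) \<ge> 1"
      using divisor_count_pos[OF q(1)] by simp
    with Mx have "128 < M * x ^ 2" by linarith
    then have "128 * real q ^ 8 < M * x ^ 2 * real q ^ 8"
      using q(1) by (intro mult_strict_right_mono) auto
    also have "\<dots> = M * (real (card \<A>) * real (card (A \<times> B))) ^ 2"
      unfolding card_cartesian_product of_nat_mult card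
      by (simp add: x_def eval_nat_numeral algebra_simps)
    finally have large: "128 * real q ^ 8 < M * (real (card \<A>) * real (card (A \<times> B))) ^ 2" .
    obtain a b where "a \<in> \<A>" "b \<in> A \<times> B" "(fst a - fst b) * (snd a - snd b) mod int q = l"
      by (rule hyperbola_solvable[OF q(2) _ sub(3) Sigma_mono[OF sub(1) sub(2)] l _ M2 large])
        (use q3 primes in auto)
    then show ?thesis by blast
  qed
  then show "l \<in> {((a\<^sub>1 - b\<^sub>1) * (a\<^sub>2 - b\<^sub>2)) mod int q | a\<^sub>1 a\<^sub>2 b\<^sub>1 b\<^sub>2.
      (a\<^sub>1, a\<^sub>2) \<in> \<A> \<and> (b\<^sub>1, b\<^sub>2) \<in> A \<times> B}"
    by fastforce
qed simp_all

end
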